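(* Let $n,m\in\mathbb{N}=\{0,1,2,\ldots\}$. Then $$xP_{n,n+m}(x)=P_{n+1,n+m}(x)+c_{n,n+m}P_{n,n+m}(x)+a_{n,n+m}P_{n-1,n+m}(x)+b_{n,n+m}P_{n,n+m-1}(x),$$ $$xP_{n,n+m}(x)=P_{n,n+m+1}(x)+d_{n,n+m}P_{n,n+m}(x)+a_{n,n+m}P_{n-1,n+m}(x)+b_{n,n+m}P_{n,n+m-1}(x),$$ where $$c_{n,n+m}=\begin{cases}\frac{\Gamma(2/3)}{\Gamma(1/3)}e^{\pi i/3}, & m=0,\\ -b_{m-1}e^{-\pi i/3}, & m>0,\end{cases}\qquad d_{n,n+m}=b_me^{-\pi i/3},$$ $$a_{n,n+m}=\begin{cases}-\frac{n}{3\sqrt3}\frac{\Gamma(1/3)}{\Gamma(2/3)}i, & m=0,\\ -\frac{n a_m}{m}e^{\pi i/3}, & m>0,\end{cases}\qquad b_{n,n+m}=\begin{cases}\frac{n}{3\sqrt3}\frac{\Gamma(1/3)}{\Gamma(2/3)}i, & m=0,\\ \frac{(n+m)a_m}{m}e^{\pi i/3}, & m>0.\end{cases}$$ Similarly, $$xP_{n+m,n}(x)=P_{n+m+1,n}(x)+c_{n+m,n}P_{n+m,n}(x)+a_{n+m,n}P_{n+m-1,n}(x)+b_{n+m,n}P_{n+m,n-1}(x),$$ $$xP_{n+m,n}(x)=P_{n+m,n+1}(x)+d_{n+m,n}P_{n+m,n}(x)+a_{n+m,n}P_{n+m-1,n}(x)+b_{n+m,n}P_{n+m,n-1}(x),$$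 where $$c_{n+m,n}=b_me^{\pi i/3},\qquad d_{n+m,n}=\begin{cases}\frac{\Gamma(2/3)}{\Gamma(1/3)}e^{-\pi i/3}, & m=0,\\ -b_{m-1}e^{\pi i/3}, & m>0,\end{cases}$$ $$a_{n+m,n}=\begin{cases}-\frac{n}{3\sqrt3}\frac{\Gamma(1/3)}{\Gamma(2/3)}i, & m=0,\\ \frac{(n+m)a_m}{m}e^{-\pi i/3}, & m>0,\end{cases}\qquad b_{n+m,n}=\begin{cases}\frac{n}{3\sqrt3}\frac{\Gamma(1/3)}{\Gamma(2/3)}i, & m=0,\\ -\frac{n a_m}{m}e^{-\pi i/3}, & m>0.\end{cases}$$ (Single-index $a_m,b_m$ denote the real sequences defined in the context; double-index $a_{k,l},b_{k,l},c_{k,l},d_{k,l}$ are the recurrence coefficients given by these formulas.)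
   Context: Let $\omega=e^{2\pi i/3}$ and, for $k=0,1,2$, let $\Gamma_k=\{r\omega^k: r\ge 0\}$ be the closed ray in $\mathbb{C}$ from the origin in direction $\omega^k$. All rays are oriented from left to right, so $\Gamma_0$ goes from $0$ to $+\infty$, while $\Gamma_1,\Gamma_2$ go from infinity to $0$. Thus for $j=1,2$ $$\int_{\Gamma_0\cup\Gamma_j} f(x)\,dx=\int_0^\infty f(t)\,dt-\omega^j\int_0^\infty f(\omega^j t)\,dt .$$ For $(k,l)\in\mathbb{N}^2$, $P_{k,l}$ is the monic polynomial of degree $k+l$ satisfying $$\int_{\Gamma_0\cup\Gamma_1}x^iP_{k,l}(x)e^{-x^3}dx=0,\quad i=0,1,\ldots,k-1,$$ $$\int_{\Gamma_0\cup\Gamma_2}x^iP_{k,l}(x)e^{-x^3}dx=0,\quad i=0,1,\ldots,l-1.$$ Standing assumption: for every $(k,l)\in\mathbb{N}^2$ there is exactly one such monic polynomial of degree $k+l$. Convention: terms containing a $P_{k,l}$ with a negative index are zero (their coefficients vanish). The real sequences $(a_n)_{n\in\mathbb{N}}$, $(b_n)_{n\in\mathbb{N}}$ are those generated by $$a_n+a_{n+1}=b_n^2\quad(n\ge0),\qquad 3a_n(b_n+b_{n-1})=n\quad(n\ge1),$$ with initial conditions $a_0=0$, $b_0=\Gamma(2/3)/\Gamma(1/3)$. *)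

theory Defs
  imports "HOL-Analysis.Analysis" "HOL-Computational_Algebra.Polynomial"
begin

definition omega :: complex where
  "omega = exp (2 * of_real pi * \<i> / 3)"

text \<open>Integral along the ray \<open>{r z | r \<ge> 0}\<close>, oriented from the origin to infinity.\<close>

definition ray_integral :: "complex \<Rightarrow> (complex \<Rightarrow> complex) \<Rightarrow> complex" where
  "ray_integral z f = z * (LINT t:{0..}|lborel. f (z * of_real t))"

text \<open>The ray in direction \<open>omega ^ j\<close> is oriented towards the origin, hence the minus sign.\<close>

definition wedge_integral :: "nat \<Rightarrow> (complex \<Rightarrow> complex) \<Rightarrow> complex" where
  "wedge_integral j f = ray_integral 1 f - ray_integral (omega ^ j) f"

definition is_mop :: "nat \<Rightarrow> nat \<Rightarrow> complex poly \<Rightarrow> bool" where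
  "is_mop k l p \<longleftrightarrow>
     degree p = k + l \<and> lead_coeff p = 1 \<and>
     (\<forall>i<k. wedge_integral 1 (\<lambda>x. x ^ i * poly p x * exp (- (x ^ 3))) = 0) \<and>
     (\<forall>i<l. wedge_integral 2 (\<lambda>x. x ^ i * poly p x * exp (- (x ^ 3))) = 0)"

text \<open>Integer indices, so that the polynomials with a negative index are zero by convention.\<close>

definition mop :: "int \<Rightarrow> int \<Rightarrow> complex poly" where
  "mop k l = (if k < 0 \<or> l < 0 then 0 else (THE p. is_mop (nat k) (nat l) p))"

definition painleve_seqs :: "(nat \<Rightarrow> real) \<Rightarrow> (nat \<Rightarrow> real) \<Rightarrow> bool" where
  "painleve_seqs a b \<longleftrightarrow>
     a 0 = 0 \<and> b 0 = Gamma (2/3) / Gamma (1/3) \<and>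
     (\<forall>n. a n + a (n + 1) = (b n)\<^sup>2) \<and>
     (\<forall>n\<ge>1. 3 * a n * (b n + b (n - 1)) = real n)"

text \<open>
  Recurrence coefficients. The suffix \<open>upper\<close> refers to the double index \<open>(n, n + m)\<close>,
  the suffix \<open>lower\<close> to \<open>(n + m, n)\<close>; the arguments \<open>a\<close>, \<open>b\<close> are the single-index sequences.
\<close>

definition c_upper :: "(nat \<Rightarrow> real) \<Rightarrow> nat \<Rightarrow> nat \<Rightarrow> complex" where
  "c_upper b n m =
     (if m = 0 then of_real (Gamma (2/3) / Gamma (1/3)) * exp (of_real pi * \<i> / 3)
      else - of_real (b (m - 1)) * exp (- (of_real pi * \<i> / 3)))"

definition d_upper :: "(nat \<Rightarrow> real) \<Rightarrow> nat \<Rightarrow> nat \<Rightarrow> complex" where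
  "d_upper b n m = of_real (b m) * exp (- (of_real pi * \<i> / 3))"

definition a_upper :: "(nat \<Rightarrow> real) \<Rightarrow> nat \<Rightarrow> nat \<Rightarrow> complex" where
  "a_upper a n m =
     (if m = 0 then - of_real (real n / (3 * sqrt 3) * (Gamma (1/3) / Gamma (2/3))) * \<i>
      else - of_real (real n * a m / real m) * exp (of_real pi * \<i> / 3))"

definition b_upper :: "(nat \<Rightarrow> real) \<Rightarrow> nat \<Rightarrow> nat \<Rightarrow> complex" where
  "b_upper a n m =
     (if m = 0 then of_real (real n / (3 * sqrt 3) * (Gamma (1/3) / Gamma (2/3))) * \<i>
      else of_real (real (n + m) * a m / real m) * exp (of_real pi * \<i> / 3))"

definition c_lower :: "(nat \<Rightarrow> real) \<Rightarrow> nat \<Rightarrow> nat \<Rightarrow> complex" where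
  "c_lower b n m = of_real (b m) * exp (of_real pi * \<i> / 3)"

definition d_lower :: "(nat \<Rightarrow> real) \<Rightarrow> nat \<Rightarrow> nat \<Rightarrow> complex" where
  "d_lower b n m =
     (if m = 0 then of_real (Gamma (2/3) / Gamma (1/3)) * exp (- (of_real pi * \<i> / 3))
      else - of_real (b (m - 1)) * exp (of_real pi * \<i> / 3))"

definition a_lower :: "(nat \<Rightarrow> real) \<Rightarrow> nat \<Rightarrow> nat \<Rightarrow> complex" where
  "a_lower a n m =
     (if m = 0 then - of_real (real n / (3 * sqrt 3) * (Gamma (1/3) / Gamma (2/3))) * \<i>
      else of_real (real (n + m) * a m / real m) * exp (- (of_real pi * \<i> / 3)))"

definition b_lower :: "(nat \<Rightarrow> real) \<Rightarrow> nat \<Rightarrow> nat \<Rightarrow> complex" where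
  "b_lower a n m =
     (if m = 0 then of_real (real n / (3 * sqrt 3) * (Gamma (1/3) / Gamma (2/3))) * \<i>
      else - of_real (real n * a m / real m) * exp (- (of_real pi * \<i> / 3)))"

end

theory Submission
  imports Defs
begin

text \<open>
  On \<open>P\<^bsub>0,m\<^esub>\<close>, monic orthogonal for the single functional \<open>L\<^sub>2\<close> on \<open>\<Gamma>\<^sub>0 \<union> \<Gamma>\<^sub>2\<close>, the string
  equations say that the three-term coefficients are \<open>\<alpha>\<^sub>m = a\<^sub>m e\<^bsup>\<pi>i/3\<^esup>\<close> and
  \<open>\<beta>\<^sub>m = b\<^sub>m e\<^bsup>-\<pi>i/3\<^esup>\<close>. They also turn the derivative into
  \<open>P'\<^sub>m = 3 x\<^sup>2 P\<^sub>m - 3 P\<^sub>m\<^sub>+\<^sub>2 - 3 (\<beta>\<^sub>m\<^sub>+\<^sub>1 + \<beta>\<^sub>m) P\<^sub>m\<^sub>+\<^sub>1\<close>, while every functional with weight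
  \<open>e\<^bsup>-x^3\<^esup>\<close> satisfies \<open>L(p') = 3 L(x\<^sup>2 p)\<close>; hence
  \<open>L(P\<^sub>m\<^sub>+\<^sub>2) = - (\<beta>\<^sub>m\<^sub>+\<^sub>1 + \<beta>\<^sub>m) L(P\<^sub>m\<^sub>+\<^sub>1)\<close>. For \<open>L\<^sub>2\<close> the right-hand side starts at zero, which gives
  orthogonality; for \<open>L\<^sub>1\<close> it gives the ratios \<open>\<delta>\<^sub>m = L\<^sub>1(P\<^sub>m\<^sub>+\<^sub>1) / L\<^sub>1(P\<^sub>m)\<close>.
  With these, \<open>P\<^bsub>n+1,l\<^esub> = P\<^bsub>n,l+1\<^esub> - \<delta>\<^bsub>l-n\<^esub> P\<^bsub>n,l\<^esub>\<close> produces all polynomials with \<open>l \<ge> n\<close>: the recurrence,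
  with coefficients determined by \<open>3 \<alpha>\<^sub>m \<delta>\<^sub>m = - m\<close>, is carried along by pure algebra, and it shows
  that the ratios \<open>\<delta>\<^sub>m\<close> do not depend on \<open>n\<close>. Complex conjugation exchanges \<open>\<Gamma>\<^sub>1\<close> and \<open>\<Gamma>\<^sub>2\<close> and
  reduces the case \<open>l \<le> n\<close> to the case \<open>l \<ge> n\<close>.
\<close>

section \<open>Linear functionals given by moments\<close>

text \<open>Linear on all polynomials without any integrability condition, so integrals are needed
  only to identify the moments.\<close>

definition moment_functional :: "(nat \<Rightarrow> complex) \<Rightarrow> complex poly \<Rightarrow> complex" where
  "moment_functional M p = (\<Sum>i\<le>degree p. coeff p i * M i)"

lemma moment_functional_eq_sum:
  assumes "degree p \<le> N"
  shows "moment_functional M p = (\<Sum>i\<le>N. coeff p i * M i)"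
  unfolding moment_functional_def using assms
  by (intro sum.mono_neutral_left) (auto simp: coeff_eq_0)

lemma moment_functional_add:
  "moment_functional M (p + q) = moment_functional M p + moment_functional M q"
proof -
  let ?N = "max (degree p) (degree q)"
  have "degree (p + q) \<le> ?N" by (rule degree_add_le_max)
  then show ?thesis
    by (simp add: moment_functional_eq_sum[of _ ?N] sum.distrib algebra_simps)
qed

lemma moment_functional_smult:
  "moment_functional M (smult c p) = c * moment_functional M p"
  by (simp add: moment_functional_eq_sum[of _ "degree p"] sum_distrib_left mult.assoc)

lemma moment_functional_diff:
  "moment_functional M (p - q) = moment_functional M p - moment_functional M q"
  using moment_functional_add[of M "p - q" q] by simp

lemmas moment_functional_linear =
  moment_functional_add moment_functional_diff moment_functional_smult

lemma moment_functional_pCons_0: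
  "moment_functional M (pCons 0 p) = moment_functional (\<lambda>i. M (Suc i)) p"
proof -
  have "degree (pCons 0 p) \<le> Suc (degree p)" by (rule degree_pCons_le)
  then show ?thesis
    by (simp add: moment_functional_eq_sum[of _ "Suc (degree p)"] sum.atMost_Suc_shift
        moment_functional_def del: sum.atMost_Suc)
qed

text \<open>Hands one factor \<open>x\<close> from the monomial to the polynomial, where a
  recurrence can be applied to it.\<close>

lemma monom_mult_pCons_0: "monom (1::complex) i * pCons 0 p = monom 1 (Suc i) * p"
  by (simp add: monom_Suc)

lemma moment_functional_map_cnj:
  assumes "\<And>i. M' i = cnj (M i)"
  shows "moment_functional M' (map_poly cnj p) = cnj (moment_functional M p)"
  by (simp add: moment_functional_def coeff_map_poly degree_map_poly assms)

text \<open>The hypothesis is the moment form of the Pearson equation \<open>w' = - 3 x\<^sup>2 w\<close>.\<close>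

lemma moment_functional_pderiv:
  assumes "M 2 = 0" and "\<And>i. 3 * M (i + 3) = of_nat (i + 1) * M i"
  shows "moment_functional M (pderiv p) = 3 * moment_functional M (pCons 0 (pCons 0 p))"
proof -
  let ?N = "degree p"
  have "3 * moment_functional M (pCons 0 (pCons 0 p))
      = (\<Sum>i\<le>Suc ?N. coeff p i * (3 * M (i + 2)))"
    by (simp add: moment_functional_pCons_0 moment_functional_eq_sum[of p "Suc ?N"]
        sum_distrib_left algebra_simps)
  \<comment> \<open>The term of index 0 carries \<open>M 2\<close> and drops out, so the sum can be
    shifted.\<close>
  also have "\<dots> = (\<Sum>i\<le>?N. coeff p (Suc i) * (3 * M (i + 3)))"
    using assms(1) by (simp add: sum.atMost_Suc_shift numeral_eq_Suc del: sum.atMost_Suc)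
  also have "\<dots> = (\<Sum>i\<le>?N. coeff (pderiv p) i * M i)"
    by (intro sum.cong) (simp_all only: assms(2), simp_all add: coeff_pderiv)
  also have "\<dots> = moment_functional M (pderiv p)"
    by (rule moment_functional_eq_sum[symmetric]) (simp add: degree_pderiv)
  finally show ?thesis ..
qed

section \<open>The wedge integrals as moment functionals\<close>

definition ray_moment :: "nat \<Rightarrow> real" where
  "ray_moment n = Gamma (real (n + 1) / 3) / 3"

text \<open>Substituting \<open>x = omega ^ j * t\<close> gives \<open>n\<close> factors
  \<open>omega ^ j\<close> from the monomial and one from \<open>dx\<close>.\<close>

definition wedge_moment :: "nat \<Rightarrow> nat \<Rightarrow> complex" where
  "wedge_moment j n = (1 - omega ^ (j * (n + 1))) * of_real (ray_moment n)"

text \<open>The substitution \<open>u = t ^ 3\<close> leads to the Gamma integral at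
  \<open>s = (n + 1) / 3\<close>.\<close>

lemma has_integral_ray_moment:
  "((\<lambda>t::real. t ^ n * exp (- (t ^ 3))) has_integral ray_moment n) {0..}"
proof -
  define s where "s = real (n + 1) / 3"
  have s: "s > 0" by (simp add: s_def)
  define f where "f = (\<lambda>u::real. u powr (s - 1) / exp u)"
  have img: "(\<lambda>t::real. t ^ 3) ` {0<..} = {0<..}"
  proof (intro equalityI subsetI)
    fix u :: real assume "u \<in> {0<..}"
    then show "u \<in> (\<lambda>t. t ^ 3) ` {0<..}"
      by (intro image_eqI[of _ _ "root 3 u"]) (auto simp: real_root_pow_pos2)
  qed auto
  \<comment> \<open>The endpoint 0 is negligible and is left out until the end: for
    \<open>n = 0\<close> the transformed integrand differs from the original one there.\<close>
  have fint: "(f has_integral Gamma s) {0<..}"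
  proof -
    have "(f has_integral Gamma s) {0..}"
      using Gamma_integral_real[OF s] by (simp add: f_def)
    then show ?thesis
      by (subst has_integral_spike_set_eq[where T = "{0..}"])
         (auto intro: negligible_subset[of "{0}"])
  qed
  have "f absolutely_integrable_on {0<..}"
    using fint by (subst absolutely_integrable_on_iff_nonneg) (auto simp: f_def)
  then have "f absolutely_integrable_on (\<lambda>t. t ^ 3) ` {0<..}
      \<and> integral ((\<lambda>t. t ^ 3) ` {0<..}) f = Gamma s"
    using fint by (simp add: img integral_unique)
  then have "(\<lambda>t. \<bar>3 * t ^ 2\<bar> * f (t ^ 3)) absolutely_integrable_on {0<..}
      \<and> integral {0<..} (\<lambda>t. \<bar>3 * t ^ 2\<bar> * f (t ^ 3)) = Gamma s"
    by (subst has_absolute_integral_change_of_variables_1')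
       (auto intro!: derivative_eq_intros inj_onI dest: power_eq_imp_eq_base)
  then have "((\<lambda>t. \<bar>3 * t ^ 2\<bar> * f (t ^ 3)) has_integral Gamma s) {0<..}"
    using set_lebesgue_integral_eq_integral(1) by (metis integrable_integral)
  then have "((\<lambda>t. (1/3) * (\<bar>3 * t ^ 2\<bar> * f (t ^ 3))) has_integral (1/3) * Gamma s) {0<..}"
    by (rule has_integral_mult_right)
  moreover have "(1/3) * (\<bar>3 * t ^ 2\<bar> * f (t ^ 3)) = t ^ n * exp (- (t ^ 3))" if "t > 0" for t
  proof -
    have "t ^ 2 * (t ^ 3) powr (s - 1) = t powr 2 * (t powr 3) powr (s - 1)"
      using that by (simp add: powr_numeral)
    also have "\<dots> = t powr (2 + 3 * (s - 1))"
      by (simp only: powr_powr powr_add)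
    also have "\<dots> = t ^ n"
      using that by (simp add: s_def diff_divide_distrib add_divide_distrib flip: powr_realpow)
    finally show ?thesis by (simp add: f_def exp_minus divide_simps)
  qed
  ultimately have "((\<lambda>t. t ^ n * exp (- (t ^ 3))) has_integral (1/3) * Gamma s) {0<..}"
    by (subst has_integral_cong) auto
  then have "((\<lambda>t. t ^ n * exp (- (t ^ 3))) has_integral (1/3) * Gamma s) {0..}"
    by (subst has_integral_spike_set_eq[where T = "{0<..}"])
       (auto intro: negligible_subset[of "{0}"])
  then show ?thesis by (simp add: s_def ray_moment_def)
qed

lemma
  shows set_integrable_ray_moment:
      "set_integrable lborel {0..} (\<lambda>t::real. t ^ n * exp (- (t ^ 3)))"
    and integral_ray_moment:
      "(LINT t:{0..}|lborel. t ^ n * exp (- (t ^ 3))) = ray_moment n"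
proof -
  have "(\<lambda>t::real. t ^ n * exp (- (t ^ 3))) absolutely_integrable_on {0..}"
    using has_integral_ray_moment
    by (subst absolutely_integrable_on_iff_nonneg) (auto simp: integrable_on_def)
  then show I: "set_integrable lborel {0..} (\<lambda>t::real. t ^ n * exp (- (t ^ 3)))"
    unfolding set_integrable_def by (subst (asm) integrable_completion) auto
  show "(LINT t:{0..}|lborel. t ^ n * exp (- (t ^ 3))) = ray_moment n"
    using set_borel_integral_eq_integral(2)[OF I] has_integral_ray_moment
    by (simp add: integral_unique)
qed

lemma set_integral_sum:
  fixes f :: "_ \<Rightarrow> _ \<Rightarrow> _ :: {banach, second_countable_topology}"
  assumes "\<And>i. i \<in> I \<Longrightarrow> set_integrable M A (f i)"
  shows "(LINT x:A|M. (\<Sum>i\<in>I. f i x)) = (\<Sum>i\<in>I. LINT x:A|M. f i x)"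
  using assms unfolding set_integrable_def set_lebesgue_integral_def
  by (simp add: scaleR_sum_right integral_sum)

text \<open>As \<open>z ^ 3 = 1\<close>, the weight takes the same values on the rotated ray as on
  the positive axis.\<close>

lemma ray_integral_poly:
  assumes "z ^ 3 = 1"
  shows "ray_integral z (\<lambda>x. poly p x * exp (- (x ^ 3)))
       = moment_functional (\<lambda>n. z ^ (n + 1) * of_real (ray_moment n)) p"
proof -
  have I: "set_integrable lborel {0..} (\<lambda>t. of_real (t ^ n * exp (- (t ^ 3))) :: complex)" for n
    using set_integrable_ray_moment[of n] unfolding set_integrable_def
    by (simp add: scaleR_conv_of_real flip: of_real_mult)
  have "(LINT t:{0..}|lborel. poly p (z * of_real t) * exp (- ((z * of_real t) ^ 3)))
      = (LINT t:{0..}|lborel. \<Sum>n\<le>degree p.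
           coeff p n * z ^ n * of_real (t ^ n * exp (- (t ^ 3))))"
    using assms
    by (simp add: poly_altdef power_mult_distrib sum_distrib_left algebra_simps exp_of_real
        flip: of_real_power of_real_minus)
  also have "\<dots> = (\<Sum>n\<le>degree p. coeff p n * z ^ n * of_real (ray_moment n))"
    using I integral_ray_moment
    by (subst set_integral_sum) (auto simp: set_integral_complex_of_real simp del: of_real_mult of_real_power)
  finally show ?thesis
    by (simp add: ray_integral_def moment_functional_def sum_distrib_left algebra_simps)
qed

lemma omega_Complex: "omega = Complex (- 1 / 2) (sqrt 3 / 2)"
proof -
  have "omega = cis (2 * pi / 3)"
    by (simp add: omega_def cis_conv_exp algebra_simps)
  then show ?thesis
    by (simp add: complex_eq_iff cos_120 sin_120)
qed

lemma omega_square: "omega ^ 2 = - 1 - omega"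
  by (simp add: omega_Complex complex_eq_iff power2_eq_square field_simps)

lemma omega_cube: "omega ^ 3 = 1"
  using omega_square by algebra

lemma cnj_omega: "cnj omega = omega ^ 2"
  by (simp add: omega_square) (simp add: omega_Complex complex_eq_iff)

lemma wedge_integral_poly:
  "wedge_integral j (\<lambda>x. x ^ i * poly p x * exp (- (x ^ 3)))
     = moment_functional (wedge_moment j) (monom 1 i * p)"
proof -
  have "(omega ^ j) ^ 3 = 1"
    by (metis omega_cube mult.commute power_mult power_one)
  then have "wedge_integral j (\<lambda>x. poly q x * exp (- (x ^ 3)))
     = moment_functional (wedge_moment j) q" for q
    by (simp add: wedge_integral_def ray_integral_poly moment_functional_def wedge_moment_def
        sum_subtractf algebra_simps power_add flip: power_mult)
  from this[of "monom 1 i * p"] show ?thesis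
    by (simp add: poly_monom)
qed

lemma wedge_moment_2: "wedge_moment j 2 = 0"
proof -
  have "omega ^ (j * (2 + 1)) = 1"
    using omega_cube by (metis mult.commute numeral_plus_one power_mult power_one semiring_norm(5) add_2_eq_Suc')
  then show ?thesis by (simp add: wedge_moment_def)
qed

text \<open>This is \<open>Gamma (s + 1) = s * Gamma s\<close> at \<open>s = (i + 1) / 3\<close>; a
  shift of \<open>i\<close> by 3 leaves the power of \<open>omega\<close> unchanged.\<close>

lemma wedge_moment_pearson: "3 * wedge_moment j (i + 3) = of_nat (i + 1) * wedge_moment j i"
proof -
  have "ray_moment (i + 3) = real (i + 1) / 3 * ray_moment i"
    using Gamma_plus1[of "real (i + 1) / 3"] nonpos_Ints_nonpos[of "real (i + 1) / 3"]
    by (fastforce simp: ray_moment_def add_divide_distrib add_ac)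
  moreover have "omega ^ (j * (i + 3 + 1)) = omega ^ (j * (i + 1)) * (omega ^ 3) ^ j"
    by (simp add: algebra_simps flip: power_mult power_add)
  moreover have "3 * ((1 - w) * complex_of_real (real (i + 1) / 3 * r))
      = of_nat (i + 1) * ((1 - w) * of_real r)" for w r
    by (simp add: field_simps)
  ultimately show ?thesis
    by (simp only: wedge_moment_def omega_cube power_one mult_1_right)
qed

lemma wedge_moment_cnj: "wedge_moment 2 i = cnj (wedge_moment 1 i)"
  by (simp add: wedge_moment_def cnj_omega power2_eq_square mult_2 power_add power_mult_distrib)

section \<open>Rows of polynomials generated by a ladder relation\<close>

lemma three_term_structure_1:
  fixes x :: complex
  assumes "b1 = x - \<beta>0" and "b2 = (x - \<beta>1) * b1 - \<alpha>1"
    and "b3 = (x - \<beta>2) * b2 - \<alpha>2 * b1"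
    and "3 * \<alpha>1 * (\<beta>1 + \<beta>0) = 1"
    and "\<alpha>1 = - (\<beta>0^2)" and "\<alpha>1 + \<alpha>2 = - (\<beta>1^2)"
  shows "1 = 3 * x^2 * b1 - 3 * b3 - 3 * (\<beta>2 + \<beta>1) * b2"
  using assms by algebra

text \<open>Here \<open>b0\<close>, \<open>b1\<close>, ... are consecutive values of
  \<open>base\<close> and \<open>d0\<close>, \<open>d1\<close>, \<open>d2\<close> their derivatives.
  After substitution, the product-rule term \<open>b1\<close> is cancelled by the increase from
  \<open>k\<close> to \<open>k + 1\<close>, and the coefficient of \<open>b2\<close> vanishes by
  subtracting the last two hypotheses.\<close>

lemma three_term_structure_step:
  fixes x :: complex
  assumes "b2 = (x - \<beta>1) * b1 - \<alpha>1 * b0"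
    and "b3 = (x - \<beta>2) * b2 - \<alpha>2 * b1"
    and "b4 = (x - \<beta>3) * b3 - \<alpha>3 * b2"
    and "d0 = 3 * x^2 * b0 - 3 * b2 - 3 * (\<beta>1 + \<beta>0) * b1"
    and "d1 = 3 * x^2 * b1 - 3 * b3 - 3 * (\<beta>2 + \<beta>1) * b2"
    and "d2 = b1 + (x - \<beta>1) * d1 - \<alpha>1 * d0"
    and "3 * \<alpha>1 * (\<beta>1 + \<beta>0) = k"
    and "3 * \<alpha>2 * (\<beta>2 + \<beta>1) = k + 1"
    and "\<alpha>1 + \<alpha>2 = - (\<beta>1^2)"
    and "\<alpha>2 + \<alpha>3 = - (\<beta>2^2)"
  shows "d2 = 3 * x^2 * b2 - 3 * b4 - 3 * (\<beta>3 + \<beta>2) * b3"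
  using assms by algebra

lemma ladder_first_row_identity:
  fixes x :: complex
  assumes "b2 = (x - \<beta>1) * b1 - \<alpha>1 * b0"
    and "b3 = (x - \<beta>2) * b2 - \<alpha>2 * b1"
    and "\<delta>1 = - (\<beta>1 + \<beta>0)" and "\<delta>2 = - (\<beta>2 + \<beta>1)"
    and "\<alpha>0 + \<alpha>1 = - (\<beta>0^2)" and "\<alpha>1 + \<alpha>2 = - (\<beta>1^2)"
  shows "x * (b2 - \<delta>1 * b1) = (b3 - \<delta>2 * b2) + \<beta>0 * (b2 - \<delta>1 * b1) + \<alpha>0 * b1 - \<alpha>1 * \<delta>1 * b0"
  using assms by algebra
text \<open>With \<open>p\<close>, \<open>q\<close> from two consecutive rows: the recurrence at
  \<open>q2\<close> minus \<open>\<delta>1\<close> times the one at \<open>q1\<close>, rearranged by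
  the string equations. Multiplying by 3 first clears the denominators.\<close>

lemma ladder_step_identity:
  fixes x :: complex
  assumes "x * q2 = q3 + \<beta>2 * q2 + \<alpha>2 * p3 + (k + 2) / 3 * p2"
    and "x * q1 = q2 + \<beta>1 * q1 + \<alpha>1 * p2 + (k + 1) / 3 * p1"
    and "q1 = p3 - \<delta>2 * p2" and "q0 = p2 - \<delta>1 * p1"
    and "\<delta>1 = - (\<beta>1 + \<beta>0)" and "\<delta>2 = - (\<beta>2 + \<beta>1)"
    and "3 * \<alpha>1 * \<delta>1 = - (M + 1)" and "3 * \<alpha>2 * \<delta>2 = - (M + 2)"
    and "\<alpha>0 + \<alpha>1 = - (\<beta>0^2)" and "\<alpha>1 + \<alpha>2 = - (\<beta>1^2)"
  shows "x * (q2 - \<delta>1 * q1) = (q3 - \<delta>2 * q2) + \<beta>0 * (q2 - \<delta>1 * q1) + \<alpha>0 * q1 + (k + 1) / 3 * q0"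
proof -
  have "3 * (x * q2) = 3 * (q3 + \<beta>2 * q2 + \<alpha>2 * p3) + (k + 2) * p2"
       "3 * (x * q1) = 3 * (q2 + \<beta>1 * q1 + \<alpha>1 * p2) + (k + 1) * p1"
    unfolding assms(1,2) by (simp_all add: algebra_simps)
  then have "3 * (x * (q2 - \<delta>1 * q1)) = 3 * ((q3 - \<delta>2 * q2) + \<beta>0 * (q2 - \<delta>1 * q1) + \<alpha>0 * q1) + (k + 1) * q0"
    using assms(3-) by algebra
  then show ?thesis by (simp add: field_simps)
qed

text \<open>The string equations after rotation by powers of \<open>omega\<close>. They leave
  \<open>\<delta> 0\<close> free, since \<open>alpha_delta\<close> is trivial at 0; its value comes
  from the moments.\<close>

locale ladder =
  fixes \<alpha> \<beta> \<delta> :: "nat \<Rightarrow> complex"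
  assumes alpha_0: "\<alpha> 0 = 0"
    and alpha_sum: "\<alpha> m + \<alpha> (Suc m) = - (\<beta> m)\<^sup>2"
    and delta_Suc: "\<delta> (Suc m) = - (\<beta> (Suc m) + \<beta> m)"
    and alpha_delta: "3 * \<alpha> m * \<delta> m = - of_nat m"
begin

fun base :: "nat \<Rightarrow> complex poly" where
  "base 0 = 1"
| "base (Suc 0) = [:- \<beta> 0, 1:]"
| "base (Suc (Suc m)) =
     pCons 0 (base (Suc m)) - smult (\<beta> (Suc m)) (base (Suc m)) - smult (\<alpha> (Suc m)) (base m)"

text \<open>\<open>row n m\<close> stands for \<open>P\<^bsub>n,n+m\<^esub>\<close>.\<close>

primrec row :: "nat \<Rightarrow> nat \<Rightarrow> complex poly" where
  "row 0 = base"
| "row (Suc n) = (\<lambda>m. row n (m + 2) - smult (\<delta> (m + 1)) (row n (m + 1)))"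

text \<open>At \<open>m = 0\<close> the truncated index \<open>m - 1\<close> is harmless because
  \<open>\<alpha> 0 = 0\<close>.\<close>

lemma base_recurrence:
  "pCons 0 (base m) = base (Suc m) + smult (\<beta> m) (base m) + smult (\<alpha> m) (base (m - 1))"
  by (cases m) (simp_all add: alpha_0 one_pCons)

text \<open>At the index \<open>(n + 1, n + 1 + m)\<close> the lower neighbours are
  \<open>row n (Suc m)\<close> and \<open>row n (Suc m) - \<delta> m * row n m\<close>. With
  coefficients \<open>A\<close> and \<open>B\<close> they contribute
  \<open>A + B = \<alpha> m\<close> and \<open>- B * \<delta> m = (n + 1 + m) / 3\<close>, a form
  that needs no separate case \<open>m = 0\<close>.\<close>

lemma poly_row_Suc_recurrence:
  "x * poly (row (Suc n) m) x =
     poly (row (Suc n) (Suc m)) x + \<beta> m * poly (row (Suc n) m) x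
     + \<alpha> m * poly (row n (Suc m)) x + of_nat (Suc n + m) / 3 * poly (row n m) x"
proof (induction n arbitrary: m)
  case 0
  have "x * (poly (base (m + 2)) x - \<delta> (m + 1) * poly (base (m + 1)) x) =
     (poly (base (m + 3)) x - \<delta> (m + 2) * poly (base (m + 2)) x)
     + \<beta> m * (poly (base (m + 2)) x - \<delta> (m + 1) * poly (base (m + 1)) x)
     + \<alpha> m * poly (base (m + 1)) x - \<alpha> (m + 1) * \<delta> (m + 1) * poly (base m) x"
    by (rule ladder_first_row_identity[where ?\<alpha>2.0 = "\<alpha> (m + 2)" and ?\<beta>2.0 = "\<beta> (m + 2)"])
       (use alpha_sum[of m] alpha_sum[of "m + 1"] delta_Suc[of m] delta_Suc[of "m + 1"] in
         \<open>simp_all add: numeral_eq_Suc algebra_simps\<close>)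
  moreover have "of_nat (Suc 0 + m) = - (3 * \<alpha> (m + 1) * \<delta> (m + 1))"
    by (simp only: alpha_delta) simp
  ultimately show ?case
    by (simp only:) (simp add: numeral_eq_Suc)
next
  case (Suc n)
  define p where "p = (\<lambda>j. poly (row n j) x)"
  define q where "q = (\<lambda>j. poly (row (Suc n) j) x)"
  define N where "N = (of_nat n :: complex)"
  define M where "M = (of_nat m :: complex)"
  have IH: "x * q j = q (j + 1) + \<beta> j * q j + \<alpha> j * p (j + 1) + (N + 1 + of_nat j) / 3 * p j" for j
    using Suc.IH[of j] unfolding p_def q_def N_def by (simp add: add_ac)
  have q: "q j = p (j + 2) - \<delta> (j + 1) * p (j + 1)" for j
    by (simp add: p_def q_def)
  have r: "poly (row (Suc (Suc n)) j) x = q (j + 2) - \<delta> (j + 1) * q (j + 1)" for j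
    by (simp add: q_def)
  have "x * (q (m + 2) - \<delta> (m + 1) * q (m + 1)) =
     (q (m + 3) - \<delta> (m + 2) * q (m + 2)) + \<beta> m * (q (m + 2) - \<delta> (m + 1) * q (m + 1))
     + \<alpha> m * q (m + 1) + ((N + M + 1) + 1) / 3 * q m"
  proof (rule ladder_step_identity)
    show "x * q (m + 2) = q (m + 3) + \<beta> (m + 2) * q (m + 2) + \<alpha> (m + 2) * p (m + 3)
        + ((N + M + 1) + 2) / 3 * p (m + 2)"
      using IH[of "m + 2"] by (simp add: M_def add_ac numeral_eq_Suc)
    show "x * q (m + 1) = q (m + 2) + \<beta> (m + 1) * q (m + 1) + \<alpha> (m + 1) * p (m + 2)
        + ((N + M + 1) + 1) / 3 * p (m + 1)"
      using IH[of "m + 1"] by (simp add: M_def add_ac numeral_eq_Suc)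
    show "q (m + 1) = p (m + 3) - \<delta> (m + 2) * p (m + 2)"
      using q[of "m + 1"] by (simp add: numeral_eq_Suc)
    show "3 * \<alpha> (m + 1) * \<delta> (m + 1) = - (M + 1)" "3 * \<alpha> (m + 2) * \<delta> (m + 2) = - (M + 2)"
      using alpha_delta[of "m + 1"] alpha_delta[of "m + 2"] by (simp_all add: M_def)
  qed (use q[of m] alpha_sum[of m] alpha_sum[of "m + 1"] delta_Suc[of m] delta_Suc[of "m + 1"] in
       \<open>simp_all add: numeral_eq_Suc\<close>)
  then show ?case
    unfolding r by (simp add: q_def N_def M_def numeral_eq_Suc algebra_simps)
qed

lemma row_Suc_recurrence:
  "pCons 0 (row (Suc n) m) =
     row (Suc n) (Suc m) + smult (\<beta> m) (row (Suc n) m)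
     + smult (\<alpha> m) (row n (Suc m)) + smult (of_nat (Suc n + m) / 3) (row n m)"
  by (rule poly_ext) (use poly_row_Suc_recurrence in simp)

text \<open>Derived from the string equations alone, without orthogonality, so any functional may be
  applied to it.\<close>

lemma pderiv_base:
  "pderiv (base m) = smult 3 (pCons 0 (pCons 0 (base m))) - smult 3 (base (m + 2))
     + smult (3 * \<delta> (m + 1)) (base (m + 1))"
proof -
  let ?P = "\<lambda>m x. poly (pderiv (base m)) x = 3 * x^2 * poly (base m) x
     - 3 * poly (base (m + 2)) x - 3 * (\<beta> (m + 1) + \<beta> m) * poly (base (m + 1)) x"
  have s: "3 * \<alpha> (m + 1) * (\<beta> (m + 1) + \<beta> m) = of_nat m + 1" for m
    using alpha_delta[of "Suc m"] delta_Suc[of m] by (simp add: algebra_simps)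
  have "?P m x" for x
  proof (induction m rule: base.induct)
    case 1
    have "\<alpha> 1 = - (\<beta> 0 ^ 2)"
      using alpha_sum[of 0] alpha_0 by simp
    then show ?case
      by (simp add: numeral_eq_Suc algebra_simps)
  next
    case 2
    have "\<alpha> 1 = - (\<beta> 0 ^ 2)"
      using alpha_sum[of 0] alpha_0 by simp
    moreover have "poly (pderiv (base (Suc 0))) x = 1"
      by (simp add: pderiv_pCons)
    moreover have "1 = 3 * x^2 * poly (base (Suc 0)) x - 3 * poly (base (Suc 0 + 2)) x
       - 3 * (\<beta> (Suc 0 + 1) + \<beta> (Suc 0)) * poly (base (Suc 0 + 1)) x"
    proof (rule three_term_structure_1)
      show "poly (base (Suc 0)) x = x - \<beta> 0"
        "poly (base (Suc 0 + 1)) x = (x - \<beta> (Suc 0)) * poly (base (Suc 0)) x - \<alpha> 1"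
        "poly (base (Suc 0 + 2)) x = (x - \<beta> (Suc 0 + 1)) * poly (base (Suc 0 + 1)) x
          - \<alpha> 2 * poly (base (Suc 0)) x"
        by (simp_all add: numeral_eq_Suc algebra_simps)
    qed (use \<open>\<alpha> 1 = - (\<beta> 0 ^ 2)\<close> s[of 0] alpha_sum[of 1] in \<open>simp_all add: numeral_eq_Suc\<close>)
    ultimately show ?case
      by (simp only:)
  next
    case (3 m)
    show ?case
    proof (rule three_term_structure_step[where ?b0.0 = "poly (base m) x" and ?b1.0 = "poly (base (m + 1)) x"])
      show "poly (base (Suc (Suc m))) x = (x - \<beta> (m + 1)) * poly (base (m + 1)) x
          - \<alpha> (m + 1) * poly (base m) x"
        "poly (base (Suc (Suc m) + 1)) x = (x - \<beta> (Suc (Suc m))) * poly (base (Suc (Suc m))) x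
          - \<alpha> (m + 2) * poly (base (m + 1)) x"
        "poly (base (Suc (Suc m) + 2)) x = (x - \<beta> (Suc (Suc m) + 1)) * poly (base (Suc (Suc m) + 1)) x
          - \<alpha> (m + 3) * poly (base (Suc (Suc m))) x"
        by (simp_all add: numeral_eq_Suc algebra_simps)
      show "poly (pderiv (base (Suc (Suc m)))) x = poly (base (m + 1)) x
          + (x - \<beta> (m + 1)) * poly (pderiv (base (m + 1))) x - \<alpha> (m + 1) * poly (pderiv (base m)) x"
        by (simp add: pderiv_pCons pderiv_add pderiv_diff pderiv_smult algebra_simps)
    qed (use 3 s[of m] s[of "m + 1"] alpha_sum[of "m + 1"] alpha_sum[of "m + 2"] in
         \<open>simp_all add: numeral_eq_Suc add_ac\<close>)
  qed
  then show ?thesis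
    by (intro poly_ext) (simp add: delta_Suc power2_eq_square algebra_simps)
qed

lemma base_monic: "degree (base m) \<le> m \<and> coeff (base m) m = 1"
proof (induction m rule: base.induct)
  case (3 m)
  then have "coeff (base (Suc m)) (Suc (Suc m)) = 0" "coeff (base m) (Suc (Suc m)) = 0"
    by (auto intro: coeff_eq_0)
  with 3 show ?case
    by (auto intro!: degree_diff_le intro: order.trans[OF degree_smult_le]
        order.trans[OF degree_pCons_le])
qed simp_all

lemma row_monic: "degree (row n m) \<le> 2 * n + m \<and> coeff (row n m) (2 * n + m) = 1"
proof (induction n arbitrary: m)
  case (Suc n)
  have "coeff (row n (m + 1)) (2 * n + m + 2) = 0"
    using Suc[of "m + 1"] by (auto intro: coeff_eq_0)
  with Suc[of "m + 1"] Suc[of "m + 2"] show ?case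
    by (auto intro!: degree_diff_le intro: order.trans[OF degree_smult_le] simp: numeral_eq_Suc)
qed (use base_monic in simp)

text \<open>Apply the functional to \<open>pderiv_base\<close>: the derivative cancels against the
  \<open>x ^ 2\<close> term.\<close>

lemma functional_base_ratio:
  assumes "M 2 = 0" "\<And>i. 3 * M (i + 3) = of_nat (i + 1) * M i"
  shows "moment_functional M (base (m + 2)) = \<delta> (m + 1) * moment_functional M (base (m + 1))"
  using moment_functional_pderiv[OF assms, of "base m"]
  by (simp add: pderiv_base moment_functional_linear moment_functional_pCons_0 del: base.simps)

end

text \<open>\<open>M\<close> and \<open>N\<close> play the parts of the moments for the first and
  the second wedge. \<open>M_1\<close> and \<open>N_1\<close> start the ratio recursion: they say
  that \<open>base 1\<close> is mapped to \<open>\<delta> 0 * M 0\<close> and to 0.\<close>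

locale ladder_moments = ladder +
  fixes M N :: "nat \<Rightarrow> complex"
  assumes M_2: "M 2 = 0" and M_pearson: "\<And>i. 3 * M (i + 3) = of_nat (i + 1) * M i"
    and N_2: "N 2 = 0" and N_pearson: "\<And>i. 3 * N (i + 3) = of_nat (i + 1) * N i"
    and M_1: "M 1 = (\<beta> 0 + \<delta> 0) * M 0"
    and N_1: "N 1 = \<beta> 0 * N 0"
begin

lemma M_base_Suc:
  "moment_functional M (base (Suc m)) = \<delta> m * moment_functional M (base m)"
proof (cases m)
  case 0
  then show ?thesis
    using M_1 by (simp add: moment_functional_def one_pCons algebra_simps)
next
  case (Suc k)
  then show ?thesis
    using functional_base_ratio[OF M_2 M_pearson, of k] by simp
qed

lemma N_base_Suc: "moment_functional N (base (Suc m)) = 0"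
proof (induction m)
  case 0
  then show ?case
    using N_1 by (simp add: moment_functional_def algebra_simps)
next
  case (Suc m)
  then show ?case
    using functional_base_ratio[OF N_2 N_pearson, of m] by simp
qed

text \<open>Trading a factor \<open>x\<close> for the three-term recurrence lowers the index by at
  most one while \<open>i\<close> drops by one.\<close>

lemma N_base_orthogonal:
  "i < m \<Longrightarrow> moment_functional N (monom 1 i * base m) = 0"
proof (induction i arbitrary: m)
  case 0
  then show ?case
    using N_base_Suc[of "m - 1"] by simp
next
  case (Suc i)
  have "monom 1 (Suc i) * base m = monom 1 i * pCons 0 (base m)"
    by (rule monom_mult_pCons_0[symmetric])
  with Suc show ?case
    by (simp add: base_recurrence distrib_left moment_functional_linear)
qed

lemma N_row_orthogonal:
  "i < n + m \<Longrightarrow> moment_functional N (monom 1 i * row n m) = 0"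
proof (induction n arbitrary: m)
  case (Suc n)
  then show ?case
    by (simp add: right_diff_distrib moment_functional_linear)
qed (simp add: N_base_orthogonal)

text \<open>Both claims must travel together: the ratio \<open>\<delta>\<close> at exponent
  \<open>n\<close> is what makes the new condition \<open>i = n\<close> hold in row
  \<open>n + 1\<close>.\<close>

lemma M_row_orthogonal:
  "(\<forall>i<n. moment_functional M (monom 1 i * row n m) = 0) \<and>
   moment_functional M (monom 1 n * row n (Suc m))
     = \<delta> m * moment_functional M (monom 1 n * row n m)"
proof (induction n arbitrary: m)
  case 0
  then show ?case by (simp add: M_base_Suc)
next
  case (Suc n)
  have orth: "moment_functional M (monom 1 i * row (Suc n) m) = 0" if "i < Suc n" for i m
  proof (cases "i = n")
    case True
    then show ?thesis
      using Suc.IH[of "m + 1"] by (simp add: right_diff_distrib moment_functional_linear)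
  next
    case False
    with that Suc.IH[of "m + 1"] Suc.IH[of "m + 2"] show ?thesis
      by (simp add: right_diff_distrib moment_functional_linear)
  qed
  \<comment> \<open>The factor \<open>\<alpha> m * \<delta> m + (n + 1 + m) / 3\<close> loses its
    dependence on \<open>m\<close>, so row \<open>n + 1\<close> inherits the ratios of row
    \<open>n\<close>.\<close>
  have norm: "moment_functional M (monom 1 (Suc n) * row (Suc n) m)
      = of_nat (Suc n) / 3 * moment_functional M (monom 1 n * row n m)" for m
  proof -
    have "monom 1 (Suc n) * row (Suc n) m = monom 1 n * pCons 0 (row (Suc n) m)"
      by (rule monom_mult_pCons_0[symmetric])
    then have "moment_functional M (monom 1 (Suc n) * row (Suc n) m)
        = (\<alpha> m * \<delta> m + of_nat (Suc n + m) / 3) * moment_functional M (monom 1 n * row n m)"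
      using orth Suc.IH[of m] unfolding row_Suc_recurrence
      by (simp add: distrib_left moment_functional_linear algebra_simps del: row.simps)
    also have "\<alpha> m * \<delta> m + of_nat (Suc n + m) / 3 = of_nat (Suc n) / 3"
      using alpha_delta[of m] by (simp add: field_simps)
    finally show ?thesis .
  qed
  show ?case
    using orth Suc.IH[of m] unfolding norm by simp
qed

end

section \<open>Identification with the multiple orthogonal polynomials\<close>

lemma is_mop_iff:
  "is_mop k l p \<longleftrightarrow> degree p \<le> k + l \<and> coeff p (k + l) = 1 \<and>
     (\<forall>i<k. moment_functional (wedge_moment 1) (monom 1 i * p) = 0) \<and>
     (\<forall>i<l. moment_functional (wedge_moment 2) (monom 1 i * p) = 0)"
  unfolding is_mop_def wedge_integral_poly
  using le_degree[of p "k + l"] by (metis le_antisym order_refl zero_neq_one)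

lemma is_mop_cnj:
  assumes "is_mop k l p"
  shows "is_mop l k (map_poly cnj p)"
proof -
  have c: "monom 1 i * map_poly cnj p = map_poly cnj (monom 1 i * p)" for i
    by (intro poly_eqI) (simp add: coeff_map_poly coeff_monom_mult)
  have "moment_functional (wedge_moment 2) (map_poly cnj q) = cnj (moment_functional (wedge_moment 1) q)"
    "moment_functional (wedge_moment 1) (map_poly cnj q) = cnj (moment_functional (wedge_moment 2) q)" for q
    by (rule moment_functional_map_cnj, simp add: wedge_moment_cnj)+
  with assms show ?thesis
    by (simp add: is_mop_iff c coeff_map_poly degree_map_poly add.commute)
qed

lemma mop_eq:
  assumes "\<And>k l. \<exists>!p. is_mop k l p" and "is_mop k l p"
  shows "mop (int k) (int l) = p"
  using assms the1_equality[of "is_mop k l" p] by (auto simp: mop_def)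

lemma mop_cnj:
  assumes normal: "\<And>k l. \<exists>!p. is_mop k l p"
  shows "mop k l = map_poly cnj (mop l k)"
proof (cases "k < 0 \<or> l < 0")
  case False
  obtain p where p: "is_mop (nat l) (nat k) p" using normal by blast
  from mop_eq[OF normal p] mop_eq[OF normal is_mop_cnj[OF p]] False
  show ?thesis by simp
qed (auto simp: mop_def)

text \<open>Reduces all exponentials to \<open>omega\<close>, leaving algebra modulo
  \<open>omega ^ 2 = - 1 - omega\<close>.\<close>

lemma omega_exp:
  shows "exp (of_real pi * \<i> / 3) = 1 + omega"
    and "exp (- (of_real pi * \<i> / 3)) = - omega"
proof -
  have e: "exp (of_real pi * \<i> / 3) = cis (pi / 3)"
    "exp (- (of_real pi * \<i> / 3)) = cis (- (pi / 3))"
    by (simp_all add: cis_conv_exp algebra_simps)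
  show "exp (of_real pi * \<i> / 3) = 1 + omega" "exp (- (of_real pi * \<i> / 3)) = - omega"
    unfolding e by (simp_all add: omega_Complex complex_eq_iff cos_60 sin_60)
qed

text \<open>The ladder data are the claimed coefficients at \<open>n = 0\<close>; subtracting the
  two claimed recurrences shows that \<open>\<delta>\<close> has to be \<open>c - d\<close>.\<close>

lemma ladder_moments_painleve:
  assumes "painleve_seqs a b"
  shows "ladder_moments (b_upper a 0) (d_upper b 0) (\<lambda>m. c_upper b 0 m - d_upper b 0 m)
    (wedge_moment 1) (wedge_moment 2)"
proof -
  have a0: "a 0 = 0" and b0: "b 0 = Gamma (2/3) / Gamma (1/3)"
    and sum: "a m + a (Suc m) = (b m)\<^sup>2"
    and str: "3 * a (Suc m) * (b (Suc m) + b m) = real (Suc m)" for m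
    using assms by (auto simp: painleve_seqs_def)
  have A: "b_upper a 0 m = of_real (a m) * (1 + omega)" for m
    using a0 by (simp add: b_upper_def omega_exp)
  have D: "d_upper b 0 m = - of_real (b m) * omega" for m
    by (simp add: d_upper_def omega_exp)
  have C0: "c_upper b 0 0 = of_real (b 0) * (1 + omega)"
    by (simp add: c_upper_def omega_exp b0)
  have CS: "c_upper b 0 (Suc m) = of_real (b m) * omega" for m
    by (simp add: c_upper_def omega_exp)
  \<comment> \<open>The initial value \<open>b 0\<close> is exactly the ratio of the first two
    moments on the positive axis.\<close>
  have mu: "ray_moment 1 = b 0 * ray_moment 0"
    using Gamma_real_pos[of "1/3"] by (simp add: ray_moment_def b0 del: Gamma_real_pos)
  show ?thesis
  proof
    show "b_upper a 0 0 = 0" by (simp add: A a0)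
  next
    fix m
    have "complex_of_real (a m) + of_real (a (Suc m)) = (of_real (b m))\<^sup>2"
      using sum[of m] by (metis of_real_add of_real_power)
    then show "b_upper a 0 m + b_upper a 0 (Suc m) = - (d_upper b 0 m)\<^sup>2"
      using omega_square unfolding A D by algebra
  next
    fix m
    show "c_upper b 0 (Suc m) - d_upper b 0 (Suc m) = - (d_upper b 0 (Suc m) + d_upper b 0 m)"
      by (simp add: CS D)
  next
    fix m
    show "3 * b_upper a 0 m * (c_upper b 0 m - d_upper b 0 m) = - of_nat m"
    proof (cases m)
      case 0
      then show ?thesis by (simp add: A a0)
    next
      case (Suc k)
      have "3 * complex_of_real (a (Suc k)) * (of_real (b (Suc k)) + of_real (b k)) = of_nat (Suc k)"
        using arg_cong[OF str[of k], of complex_of_real] by simp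
      moreover have "3 * (u * (1 + omega)) * (w * omega - - v * omega) = - k"
        if "3 * u * (v + w) = k" for u v w k
      proof -
        have "3 * (u * (1 + omega)) * (w * omega - - v * omega)
            = 3 * u * (v + w) * (omega + omega\<^sup>2)"
          by (simp add: algebra_simps power2_eq_square)
        then show ?thesis
          using that by (simp add: omega_square)
      qed
      ultimately show ?thesis
        unfolding Suc A CS D by blast
    qed
  next
    show "wedge_moment 1 1 = (d_upper b 0 0 + (c_upper b 0 0 - d_upper b 0 0)) * wedge_moment 1 0"
      by (simp add: wedge_moment_def C0 mu power2_eq_square algebra_simps flip: One_nat_def)
    show "wedge_moment 2 1 = d_upper b 0 0 * wedge_moment 2 0"
    proof -
      have "omega ^ 4 = omega"
        using omega_square by algebra
      then have "wedge_moment 2 1 = (1 - omega) * of_real (b 0) * of_real (ray_moment 0)"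
        by (simp add: wedge_moment_def mu flip: One_nat_def)
      also have "\<dots> = - of_real (b 0) * omega * ((1 - omega ^ 2) * of_real (ray_moment 0))"
        using omega_square by algebra
      finally show ?thesis
        by (simp add: D wedge_moment_def)
    qed
  qed (simp_all only: wedge_moment_2 wedge_moment_pearson)
qed

text \<open>The two combinations through which the claimed coefficients enter
  \<open>row_Suc_recurrence\<close>.\<close>

lemma upper_coefficients:
  assumes "painleve_seqs a b"
  shows "a_upper a n m + b_upper a n m = b_upper a 0 m"
    and "b_upper a n m * (c_upper b n m - d_upper b n m) = - of_nat (n + m) / 3"
proof -
  interpret ladder_moments "b_upper a 0" "d_upper b 0" "\<lambda>m. c_upper b 0 m - d_upper b 0 m"
      "wedge_moment 1" "wedge_moment 2"
    by (rule ladder_moments_painleve[OF assms])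
  show "a_upper a n m + b_upper a n m = b_upper a 0 m"
    by (simp add: a_upper_def b_upper_def field_simps)
  show "b_upper a n m * (c_upper b n m - d_upper b n m) = - of_nat (n + m) / 3"
  proof (cases "m = 0")
    case False
    then have "of_nat m * b_upper a n m = of_nat (n + m) * b_upper a 0 m"
      by (simp add: b_upper_def)
    moreover have "c_upper b n m = c_upper b 0 m" "d_upper b n m = d_upper b 0 m"
      by (simp_all add: c_upper_def d_upper_def)
    ultimately have "of_nat m * (3 * (b_upper a n m * (c_upper b n m - d_upper b n m)))
        = of_nat m * - of_nat (n + m)"
      using alpha_delta[of m] by algebra
    with False show ?thesis
      unfolding mult_cancel_left by (simp add: field_simps)
  next
    \<comment> \<open>Here \<open>alpha_delta\<close> gives no information; instead
      \<open>c - d\<close> is computed directly as \<open>\<i> * sqrt 3 * g\<close>.\<close>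
    case True
    define g where "g = Gamma (2/3 :: real) / Gamma (1/3)"
    have "g > 0"
      by (simp add: g_def Gamma_real_pos)
    have "b 0 = g"
      using assms by (simp add: painleve_seqs_def g_def)
    then have cd: "c_upper b n 0 - d_upper b n 0 = of_real g * (1 + 2 * omega)"
      unfolding c_upper_def d_upper_def omega_exp by (simp add: algebra_simps flip: g_def)
    have w: "1 + 2 * omega = of_real (sqrt 3) * \<i>"
      by (simp add: omega_Complex complex_eq_iff)
    have bn: "b_upper a n 0 = of_real (real n / (3 * sqrt 3 * g)) * \<i>"
      by (simp add: b_upper_def g_def)
    have "b_upper a n 0 * (c_upper b n 0 - d_upper b n 0)
        = of_real (real n / (3 * sqrt 3 * g) * g * sqrt 3) * (\<i> * \<i>)"
      unfolding cd w bn by simp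
    also have "real n / (3 * sqrt 3 * g) * g * sqrt 3 = real n / 3"
      using \<open>g > 0\<close> by simp
    finally show ?thesis
      using True by simp
  qed
qed

lemma mop_upper_recurrence:
  assumes normal: "\<And>k l. \<exists>!p. is_mop k l p" and seqs: "painleve_seqs a b"
  shows "x * poly (mop (int n) (int n + int m)) x =
           poly (mop (int n + 1) (int n + int m)) x
           + c_upper b n m * poly (mop (int n) (int n + int m)) x
           + a_upper a n m * poly (mop (int n - 1) (int n + int m)) x
           + b_upper a n m * poly (mop (int n) (int n + int m - 1)) x" (is ?first)
    and "x * poly (mop (int n) (int n + int m)) x =
           poly (mop (int n) (int n + int m + 1)) x
           + d_upper b n m * poly (mop (int n) (int n + int m)) x
           + a_upper a n m * poly (mop (int n - 1) (int n + int m)) x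
           + b_upper a n m * poly (mop (int n) (int n + int m - 1)) x" (is ?second)
proof -
  define \<delta> where "\<delta> = (\<lambda>m. c_upper b 0 m - d_upper b 0 m)"
  interpret ladder_moments "b_upper a 0" "d_upper b 0" \<delta> "wedge_moment 1" "wedge_moment 2"
    unfolding \<delta>_def by (rule ladder_moments_painleve[OF seqs])
  have cd: "c_upper b n m = d_upper b 0 m + \<delta> m" "d_upper b n m = d_upper b 0 m"
    by (simp_all add: \<delta>_def c_upper_def d_upper_def)
  have is_mop_row: "is_mop n (n + m) (row n m)" for n m
    using row_monic[of n m] M_row_orthogonal[of n m] N_row_orthogonal[of _ n m]
    by (simp add: is_mop_iff add_ac mult_2)
  \<comment> \<open>For \<open>m = 0\<close> this index lies across the diagonal and belongs to no
    row. The additional condition \<open>i = n\<close> holds by the ratio in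
    \<open>M_row_orthogonal\<close>.\<close>
  have is_mop_next: "is_mop (Suc n) (n + m) (row n (Suc m) - smult (\<delta> m) (row n m))" for n m
  proof -
    have "coeff (row n m) (Suc (2 * n + m)) = 0"
      using row_monic[of n m] by (auto intro: coeff_eq_0)
    then show ?thesis
      using row_monic[of n m] row_monic[of n "Suc m"] M_row_orthogonal[of n m]
        M_row_orthogonal[of n "Suc m"] N_row_orthogonal[of _ n m] N_row_orthogonal[of _ n "Suc m"]
      by (auto simp: is_mop_iff right_diff_distrib moment_functional_linear less_Suc_eq mult_2 add_ac
          intro!: degree_diff_le intro: order.trans[OF degree_smult_le])
  qed
  have mop_row: "mop (int n) (int n + int m) = row n m" for n m
    using mop_eq[OF normal is_mop_row[of n m]] by simp
  have mop_next: "mop (int n + 1) (int n + int m) = row n (Suc m) - smult (\<delta> m) (row n m)" for n m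
    using mop_eq[OF normal is_mop_next[of n m]] by (simp add: add.commute)
  have up: "mop (int n) (int n + int m + 1) = row n (Suc m)"
    using mop_row[of n "Suc m"] by (simp add: add_ac)
  show ?second
  proof (cases n)
    case 0
    have "mop 0 (int m - 1) = row 0 (m - 1)" if "m > 0"
      using that mop_row[of 0 "m - 1"] by (simp add: of_nat_diff)
    moreover have "mop (- 1) (int m) = 0" by (simp add: mop_def)
    moreover have "x * poly (row 0 m) x = poly (row 0 (Suc m)) x + d_upper b 0 m * poly (row 0 m) x
        + b_upper a 0 m * poly (row 0 (m - 1)) x"
      using arg_cong[OF base_recurrence[of m], of "\<lambda>p. poly p x"] by simp
    ultimately show ?thesis
      using up mop_row[of 0 m] 0 alpha_0 by (cases "m = 0") (simp_all add: cd)
  next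
    case (Suc k)
    have left: "mop (int n - 1) (int n + int m) = row k (Suc m)"
      using mop_row[of k "Suc m"] Suc by (simp add: add_ac)
    have down: "mop (int n) (int n + int m - 1) = row k (Suc m) - smult (\<delta> m) (row k m)"
      using mop_next[of k m] Suc by (simp add: add_ac)
    have a_eq: "a_upper a n m = b_upper a 0 m - b_upper a n m"
      using upper_coefficients(1)[OF seqs, of n m] by (simp add: algebra_simps)
    have "b_upper a n m * \<delta> m = - of_nat (n + m) / 3"
      using upper_coefficients(2)[OF seqs, of n m] by (simp only: cd add_diff_cancel_left')
    then have b_eq: "of_nat (n + m) / 3 = - (b_upper a n m * \<delta> m)"
      by simp
    show ?thesis
      using poly_row_Suc_recurrence[of x k m]
      unfolding up mop_row left down cd a_eq Suc[symmetric] b_eq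
      by (simp add: algebra_simps)
  qed
  \<comment> \<open>Passing to the neighbour \<open>(n + 1, n + m)\<close> subtracts
    \<open>\<delta> m * row n m\<close>, which \<open>c = d + \<delta> m\<close> restores.\<close>
  then show ?first
    unfolding up mop_next mop_row cd by (simp add: algebra_simps)
qed

theorem theorem1p3:
  fixes a b :: "nat \<Rightarrow> real" and n m :: nat and x :: complex
  assumes normal: "\<And>k l :: nat. \<exists>!p. is_mop k l p"
    and seqs: "painleve_seqs a b"
  shows
   "(x * poly (mop (int n) (int n + int m)) x =
           poly (mop (int n + 1) (int n + int m)) x
           + c_upper b n m * poly (mop (int n) (int n + int m)) x
           + a_upper a n m * poly (mop (int n - 1) (int n + int m)) x
           + b_upper a n m * poly (mop (int n) (int n + int m - 1)) x) \<and>
    (x * poly (mop (int n) (int n + int m)) x =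
           poly (mop (int n) (int n + int m + 1)) x
           + d_upper b n m * poly (mop (int n) (int n + int m)) x
           + a_upper a n m * poly (mop (int n - 1) (int n + int m)) x
           + b_upper a n m * poly (mop (int n) (int n + int m - 1)) x) \<and>
    (x * poly (mop (int n + int m) (int n)) x =
           poly (mop (int n + int m + 1) (int n)) x
           + c_lower b n m * poly (mop (int n + int m) (int n)) x
           + a_lower a n m * poly (mop (int n + int m - 1) (int n)) x
           + b_lower a n m * poly (mop (int n + int m) (int n - 1)) x) \<and>
    (x * poly (mop (int n + int m) (int n)) x =
           poly (mop (int n + int m) (int n + 1)) x
           + d_lower b n m * poly (mop (int n + int m) (int n)) x
           + a_lower a n m * poly (mop (int n + int m - 1) (int n)) x
           + b_lower a n m * poly (mop (int n + int m) (int n - 1)) x)"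
proof -
  \<comment> \<open>Exchanging the two indices exchanges the two directions, so \<open>c\<close>
    pairs with \<open>d\<close> and \<open>a\<close> with \<open>b\<close> under
    conjugation.\<close>
  have coeffs: "c_lower b n m = cnj (d_upper b n m)" "d_lower b n m = cnj (c_upper b n m)"
    "a_lower a n m = cnj (b_upper a n m)" "b_lower a n m = cnj (a_upper a n m)"
    by (simp_all add: c_lower_def d_lower_def a_lower_def b_lower_def c_upper_def d_upper_def
        a_upper_def b_upper_def omega_exp cnj_omega omega_square)
      (simp_all add: algebra_simps)
  note upper = mop_upper_recurrence[OF normal seqs]
  note lower = arg_cong[OF upper(1)[of "cnj x" n m], of cnj] arg_cong[OF upper(2)[of "cnj x" n m], of cnj]
  have flip: "poly (mop k l) x = cnj (poly (mop l k) (cnj x))" for k l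
    by (subst mop_cnj[OF normal]) simp
  show ?thesis
    using upper[of x n m] lower
    unfolding coeffs flip[of "int n + int m"] flip[of "int n + int m + 1"] flip[of "int n + int m - 1"]
    by (simp add: algebra_simps)
qed

end
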